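(* Let $\Omega$ and $\Omega'$ be domains of the Poincaré half-plane $\mathbb{H}$, and let $\widetilde\Omega=\Psi(S^1\times\Omega)$ and $\widetilde\Omega'=\Psi(S^1\times\Omega')$. Let $\Gamma$ be a curve family in $\Omega$ and let $\rho\in adm(\Gamma)$. Let $g:\Omega\to\Omega'$ be a quasiconformal map such that there is a quasiconformal map $f:\widetilde\Omega\to\widetilde\Omega'$ with $\Pi\circ f=g\circ\Pi$. Then $$\Pi^\ast(g_\ast\rho)=f_\ast(\Pi^\ast\rho).$$
   Context: The Heisenberg group $\mathbf{H}$ is $\mathbb{C}\times\mathbb{R}$ with law $(z,t)\ast(z',t')=(z+z',t+t'+2\Im(z\overline{z'}))$, norm $\|(z,t)\|=(|z|^4+t^2)^{1/4}$ and distance $d(p,q)=\|p^{-1}\ast q\|$. Set $Z=\partial_z+i\overline z\,\partial_t$, $\overline Z=\partial_{\overline z}-iz\,\partial_t$ and $\omega=dt-i\overline z\,dz+iz\,d\overline z$. A homeomorphism $f$ between domains of $\mathbf{H}$ is quasiconformal if $H(p,f)=\limsup_{r\to0}\frac{\max_{d(p,q)=r}d(f(p),f(q))}{\min_{d(p,q)=r}d(f(p),f(q))}$ is uniformly bounded. Standing assumption: all quasiconformal maps (in $\mathbf{H}$ and in $\mathbb{C}$) are $C^2$ and orientation preserving, and all curves are $C^1$. Such a map $f=(f_1,f_2)$ of $\mathbf{H}$ ($f_1$ complex valued, $f_2$ real valued) is contact ($f^\ast\omega=\lambda\omega$ with $\lambda$ a nowhere vanishing real function), and orientation preserving means that $\overline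 Zf_1=\mu Zf_1$ and $\overline Z(f_2+i|f_1|^2)=\mu Z(f_2+i|f_1|^2)$ for some $\mu\in L^\infty$ with $\|\mu\|_{L^\infty}<1$. The projection $\Pi:\mathbf{H}\setminus(\{0\}\times\mathbb{R})\to\mathbb{H}$ is $\Pi(z,t)=t+i|z|^2$, and $\Psi:S^1\times\mathbb{H}\to\mathbf{H}\setminus(\{0\}\times\mathbb{R})$ is the diffeomorphism $\Psi(e^{i\theta},w)=(\sqrt{\Im(w)}\,e^{i\theta},\Re(w))$. For a family $\Gamma$ of curves in a domain $\Omega\subset\mathbb{C}$, $adm(\Gamma)$ is the set of measurable $\rho:\Omega\to[0,\infty]$ with $\int_\gamma\rho\,dl=\int\rho(\gamma(s))|\dot\gamma(s)|ds\ge1$ for all $\gamma\in\Gamma$; its elements are called densities. Push-forward in $\mathbb{C}$: $g_\ast\rho=\frac{\rho}{|\partial_wg|-|\partial_{\overline w}g|}\circ g^{-1}$. Push-forward in $\mathbf{H}$: $f_\ast\widetilde\rho=\frac{\widetilde\rho}{|Zf_1|-|\overline Zf_1|}\circ f^{-1}$. Pull-back by $\Pi$: $(\Pi^\ast\rho)(z,t)=|Z\Pi(z,t)|\,\rho(\Pi(z,t))=2|z|\,\rho(t+i|z|^2)$. *)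

theory Defs
  imports "HOL-Probability.Essential_Supremum"
begin

section \<open>The Heisenberg group\<close>

text \<open>The product type carries its Euclidean norm and distance, which are not the ones
  of the Heisenberg group; it carries the right topology and differentiable structure.\<close>

type_synonym heis = "complex \<times> real"

definition heis_mult :: "heis \<Rightarrow> heis \<Rightarrow> heis" where
  "heis_mult p q = (fst p + fst q, snd p + snd q + 2 * Im (fst p * cnj (fst q)))"

definition heis_inv :: "heis \<Rightarrow> heis" where
  "heis_inv p = (- fst p, - snd p)"

lemma heis_mult_inv: "heis_mult (heis_inv p) p = (0, 0)" "heis_mult p (heis_inv p) = (0, 0)"
  by (simp_all add: heis_mult_def heis_inv_def)

definition heis_norm :: "heis \<Rightarrow> real" where
  "heis_norm p = root 4 (cmod (fst p) ^ 4 + (snd p)\<^sup>2)"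

definition heis_dist :: "heis \<Rightarrow> heis \<Rightarrow> real" where
  "heis_dist p q = heis_norm (heis_mult (heis_inv p) q)"

section \<open>Wirtinger derivatives and the horizontal vector fields\<close>

definition d_w :: "(complex \<Rightarrow> complex) \<Rightarrow> complex \<Rightarrow> complex" where
  "d_w g w = (frechet_derivative g (at w) 1 - \<i> * frechet_derivative g (at w) \<i>) / 2"

definition d_wbar :: "(complex \<Rightarrow> complex) \<Rightarrow> complex \<Rightarrow> complex" where
  "d_wbar g w = (frechet_derivative g (at w) 1 + \<i> * frechet_derivative g (at w) \<i>) / 2"

definition Z_field :: "(heis \<Rightarrow> complex) \<Rightarrow> heis \<Rightarrow> complex" where
  "Z_field h p =
     (frechet_derivative h (at p) (1, 0) - \<i> * frechet_derivative h (at p) (\<i>, 0)) / 2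
     + \<i> * cnj (fst p) * frechet_derivative h (at p) (0, 1)"

definition Zbar_field :: "(heis \<Rightarrow> complex) \<Rightarrow> heis \<Rightarrow> complex" where
  "Zbar_field h p =
     (frechet_derivative h (at p) (1, 0) + \<i> * frechet_derivative h (at p) (\<i>, 0)) / 2
     - \<i> * fst p * frechet_derivative h (at p) (0, 1)"

section \<open>Quasiconformal maps\<close>

definition is_domain :: "'a::topological_space set \<Rightarrow> bool" where
  "is_domain U \<longleftrightarrow> open U \<and> connected U \<and> U \<noteq> {}"

definition C2_on :: "('a::real_normed_vector \<Rightarrow> 'b::real_normed_vector) \<Rightarrow> 'a set \<Rightarrow> bool" where
  "C2_on f U \<longleftrightarrow>
     (\<exists>(f' :: 'a \<Rightarrow> 'a \<Rightarrow>\<^sub>L 'b) (f'' :: 'a \<Rightarrow> 'a \<Rightarrow>\<^sub>L ('a \<Rightarrow>\<^sub>L 'b)).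
        (\<forall>x\<in>U. (f has_derivative blinfun_apply (f' x)) (at x)) \<and>
        (\<forall>x\<in>U. (f' has_derivative blinfun_apply (f'' x)) (at x)) \<and>
        continuous_on U f'')"

text \<open>The dilatation \<open>H(p,f)\<close> with respect to a distance \<open>d\<close>. For \<open>p\<close> in an open set \<open>U\<close> and
  small \<open>r\<close> the sphere of radius \<open>r\<close> about \<open>p\<close> is a compact subset of \<open>U\<close>, so that for
  continuous \<open>f\<close> the supremum and infimum are a maximum and a minimum.\<close>

definition dilatation ::
    "('a \<Rightarrow> 'a \<Rightarrow> real) \<Rightarrow> 'a set \<Rightarrow> ('a \<Rightarrow> 'a) \<Rightarrow> 'a \<Rightarrow> ennreal" where
  "dilatation d U f p =
     Limsup (at_right 0) (\<lambda>r. (SUP q\<in>{q\<in>U. d p q = r}. ennreal (d (f p) (f q))) /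
                             (INF q\<in>{q\<in>U. d p q = r}. ennreal (d (f p) (f q))))"

definition metric_qc ::
    "('a::topological_space \<Rightarrow> 'a \<Rightarrow> real) \<Rightarrow> 'a set \<Rightarrow> 'a set \<Rightarrow> ('a \<Rightarrow> 'a) \<Rightarrow> bool" where
  "metric_qc d U V f \<longleftrightarrow>
     is_domain U \<and> is_domain V \<and> (\<exists>h. homeomorphism U V f h) \<and>
     (SUP p\<in>U. dilatation d U f p) < \<infinity>"

definition Linfty_less_1 :: "'a::euclidean_space set \<Rightarrow> ('a \<Rightarrow> complex) \<Rightarrow> bool" where
  "Linfty_less_1 U \<mu> \<longleftrightarrow>
     \<mu> \<in> borel_measurable (lebesgue_on U) \<and>
     esssup (lebesgue_on U) (\<lambda>x. ennreal (cmod (\<mu> x))) < 1"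

definition qc_plane :: "complex set \<Rightarrow> complex set \<Rightarrow> (complex \<Rightarrow> complex) \<Rightarrow> bool" where
  "qc_plane U V g \<longleftrightarrow>
     metric_qc dist U V g \<and> C2_on g U \<and>
     (\<exists>\<mu>. Linfty_less_1 U \<mu> \<and> (AE w in lebesgue_on U. d_wbar g w = \<mu> w * d_w g w))"

definition heis_proj :: "heis \<Rightarrow> complex" where
  "heis_proj p = of_real (snd p) + \<i> * of_real ((cmod (fst p))\<^sup>2)"

text \<open>In the second Beltrami equation below, \<open>\<lambda>p. heis_proj (f p)\<close> is
  \<open>f\<^sub>2 + \<i> |f\<^sub>1|\<^sup>2\<close>. The contact condition
  \<open>f\<^sup>* \<omega> = \<lambda> \<omega>\<close> is a consequence of bounded dilatation and
  differentiability, hence not a clause of the definition.\<close>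

definition qc_heis :: "heis set \<Rightarrow> heis set \<Rightarrow> (heis \<Rightarrow> heis) \<Rightarrow> bool" where
  "qc_heis U V f \<longleftrightarrow>
     metric_qc heis_dist U V f \<and> C2_on f U \<and>
     (\<exists>\<mu>. Linfty_less_1 U \<mu> \<and>
        (AE p in lebesgue_on U.
           Zbar_field (\<lambda>p. fst (f p)) p = \<mu> p * Z_field (\<lambda>p. fst (f p)) p \<and>
           Zbar_field (\<lambda>p. heis_proj (f p)) p = \<mu> p * Z_field (\<lambda>p. heis_proj (f p)) p))"

section \<open>The upper half-plane and its lift\<close>

definition half_plane :: "complex set" where
  "half_plane = {w. Im w > 0}"

definition heis_Psi :: "complex \<times> complex \<Rightarrow> heis" where
  "heis_Psi = (\<lambda>(u, w). (of_real (sqrt (Im w)) * u, Re w))"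

definition heis_lift :: "complex set \<Rightarrow> heis set" where
  "heis_lift \<Omega> = heis_Psi ` (sphere 0 1 \<times> \<Omega>)"

lemma heis_proj_Psi: "cmod u = 1 \<Longrightarrow> w \<in> half_plane \<Longrightarrow> heis_proj (heis_Psi (u, w)) = w"
  by (simp add: heis_proj_def heis_Psi_def half_plane_def norm_mult complex_eq_iff)

section \<open>Curve families and densities\<close>

text \<open>A curve is a parameter interval (of any kind) with a map on it; derivatives at end points
  of the interval are one-sided.\<close>

type_synonym curve = "real set \<times> (real \<Rightarrow> complex)"

definition C1_curve_in :: "complex set \<Rightarrow> curve \<Rightarrow> bool" where
  "C1_curve_in \<Omega> = (\<lambda>(I, \<gamma>).
     is_interval I \<and> interior I \<noteq> {} \<and> \<gamma> ` I \<subseteq> \<Omega> \<and>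
     (\<exists>\<gamma>'. (\<forall>s\<in>I. (\<gamma> has_vector_derivative \<gamma>' s) (at s within I)) \<and> continuous_on I \<gamma>'))"

text \<open>For Lebesgue measurable \<open>\<rho>\<close> the integrand on a curve need not be measurable, so its
  measurability is required for the line integral to make sense; it is automatic for Borel
  measurable \<open>\<rho>\<close>.\<close>

definition adm :: "complex set \<Rightarrow> curve set \<Rightarrow> (complex \<Rightarrow> ennreal) set" where
  "adm \<Omega> \<Gamma> = {\<rho>. \<rho> \<in> borel_measurable (lebesgue_on \<Omega>) \<and>
     (\<forall>(I, \<gamma>)\<in>\<Gamma>.
        let integrand = (\<lambda>s. \<rho> (\<gamma> s) * ennreal (cmod (vector_derivative \<gamma> (at s within I))))
        in integrand \<in> borel_measurable (lebesgue_on I) \<and>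
           (\<integral>\<^sup>+s. integrand s \<partial>lebesgue_on I) \<ge> 1)}"

section \<open>Push-forward and pull-back of densities\<close>

text \<open>The domain of the map is an argument because it determines the inverse. Quotients are taken
  in \<open>[0,\<infinity>]\<close>.\<close>

definition push_plane ::
    "complex set \<Rightarrow> (complex \<Rightarrow> complex) \<Rightarrow> (complex \<Rightarrow> ennreal) \<Rightarrow> complex \<Rightarrow> ennreal" where
  "push_plane U g \<rho> =
     (\<lambda>w. \<rho> w / ennreal (cmod (d_w g w) - cmod (d_wbar g w))) \<circ> inv_into U g"

definition push_heis ::
    "heis set \<Rightarrow> (heis \<Rightarrow> heis) \<Rightarrow> (heis \<Rightarrow> ennreal) \<Rightarrow> heis \<Rightarrow> ennreal" where
  "push_heis U f \<rho> =
     (\<lambda>p. \<rho> p / ennreal (cmod (Z_field (\<lambda>p. fst (f p)) p) - cmod (Zbar_field (\<lambda>p. fst (f p)) p)))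
     \<circ> inv_into U f"

definition pull_proj :: "(complex \<Rightarrow> ennreal) \<Rightarrow> heis \<Rightarrow> ennreal" where
  "pull_proj \<rho> p = ennreal (cmod (Z_field heis_proj p)) * \<rho> (heis_proj p)"

lemma has_derivative_heis_proj:
  "(heis_proj has_derivative
     (\<lambda>v. of_real (snd v) + \<i> * of_real (2 * (fst p \<bullet> fst v)))) (at p)"
proof -
  have eq: "heis_proj = (\<lambda>p. of_real (snd p) + \<i> * of_real (fst p \<bullet> fst p))"
    by (simp add: heis_proj_def fun_eq_iff power2_norm_eq_inner)
  show ?thesis unfolding eq
    by (auto intro!: derivative_eq_intros simp: inner_commute fun_eq_iff)
qed

lemma Z_field_heis_proj: "Z_field heis_proj p = 2 * \<i> * cnj (fst p)"
  unfolding Z_field_def frechet_derivative_at[OF has_derivative_heis_proj, symmetric]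
  by (simp add: complex_eq_iff inner_complex_def)

lemma pull_proj_eq: "pull_proj \<rho> (z, t) = ennreal (2 * cmod z) * \<rho> (of_real t + \<i> * of_real ((cmod z)\<^sup>2))"
  by (simp add: pull_proj_def Z_field_heis_proj heis_proj_def norm_mult)

end

theory Submission
  imports Defs
begin

text \<open>Put \<open>c = Z(\<Pi> \<circ> f) - 2\<i> \<cdot> cnj f\<^sub>1 \<cdot> Z f\<^sub>1\<close>; this is the value of
  \<open>f\<^sup>* \<omega>\<close> on \<open>Z\<close>. Since \<open>f\<^sub>2\<close> is real valued, the same expression with the conjugate field
  in place of \<open>Z\<close> is \<open>cnj c\<close>. The two Beltrami equations therefore give \<open>cnj c = \<mu> c\<close> with
  \<open>cmod \<mu> < 1\<close>, so that \<open>c\<close> vanishes almost everywhere, hence everywhere by continuity. Comparing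
  with the chain rule for \<open>g \<circ> \<Pi>\<close>, where \<open>Z\<close> annihilates \<open>cnj \<Pi>\<close>, shows that the dilatation
  factors satisfy \<open>|f\<^sub>1| (|Z f\<^sub>1| - |Zbar f\<^sub>1|) = |z| (|d_w g| - |d_wbar g|) \<circ> \<Pi>\<close>.\<close>

lemma Z_field_has_derivative:
  assumes "(h has_derivative D) (at p)"
  shows "Z_field h p = (D (1, 0) - \<i> * D (\<i>, 0)) / 2 + \<i> * cnj (fst p) * D (0, 1)"
    and "Zbar_field h p = (D (1, 0) + \<i> * D (\<i>, 0)) / 2 - \<i> * fst p * D (0, 1)"
  by (simp_all add: Z_field_def Zbar_field_def frechet_derivative_at[OF assms, symmetric])

lemma frechet_derivative_Wirtinger:
  assumes "g differentiable (at w)"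
  shows "frechet_derivative g (at w) v = d_w g w * v + d_wbar g w * cnj v"
proof -
  interpret linear "frechet_derivative g (at w)"
    using assms by (rule linear_frechet_derivative)
  have "frechet_derivative g (at w) v
      = frechet_derivative g (at w) (Re v *\<^sub>R 1 + Im v *\<^sub>R \<i>)"
    by (rule arg_cong) (simp add: complex_eq_iff)
  also have "\<dots> = of_real (Re v) * frechet_derivative g (at w) 1
      + of_real (Im v) * frechet_derivative g (at w) \<i>"
    by (simp only: add scale) (simp add: scaleR_conv_of_real)
  also have "\<dots> = d_w g w * v + d_wbar g w * cnj v"
    by (simp add: d_w_def d_wbar_def complex_eq_iff field_simps)
  finally show ?thesis .
qed

text \<open>\<open>Z\<close> sends \<Pi> = \<open>heis_proj\<close> to
  \<open>2 * \<i> * cnj z\<close> and kills \<open>cnj\<close> \<Pi>. Conjugating, the other field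
  kills \<Pi> and sends \<open>cnj\<close> \<Pi> to \<open>- 2 * \<i> * z\<close>. So each field
  sees just one Wirtinger derivative of \<open>g\<close>.\<close>

lemma Z_field_comp_heis_proj:
  assumes "g differentiable (at (heis_proj p))"
  shows "Z_field (\<lambda>p. g (heis_proj p)) p = 2 * \<i> * cnj (fst p) * d_w g (heis_proj p)"
    and "Zbar_field (\<lambda>p. g (heis_proj p)) p = - 2 * \<i> * fst p * d_wbar g (heis_proj p)"
proof -
  have "((\<lambda>p. g (heis_proj p)) has_derivative
      (\<lambda>v. frechet_derivative g (at (heis_proj p)) (of_real (snd v) + \<i> * of_real (2 * (fst p \<bullet> fst v)))))
      (at p)"
    using has_derivative_compose[OF has_derivative_heis_proj
        assms[unfolded frechet_derivative_works]] .
  note Z = Z_field_has_derivative[OF this, unfolded frechet_derivative_Wirtinger[OF assms]]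
  show "Z_field (\<lambda>p. g (heis_proj p)) p = 2 * \<i> * cnj (fst p) * d_w g (heis_proj p)"
    "Zbar_field (\<lambda>p. g (heis_proj p)) p = - 2 * \<i> * fst p * d_wbar g (heis_proj p)"
    unfolding Z by (simp_all add: complex_eq_iff inner_complex_def field_simps)
qed

lemma Z_field_eqI:
  assumes "open U" "p \<in> U" "\<And>q. q \<in> U \<Longrightarrow> h q = k q" "h differentiable (at p)"
  shows "Z_field h p = Z_field k p" "Zbar_field h p = Zbar_field k p"
proof -
  have "frechet_derivative h (at p) = frechet_derivative k (at p)"
    using has_derivative_transform_within_open[OF assms(4)[unfolded frechet_derivative_works] assms(1-3)]
    by (rule frechet_derivative_at)
  then show "Z_field h p = Z_field k p" "Zbar_field h p = Zbar_field k p"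
    by (simp_all add: Z_field_def Zbar_field_def)
qed

definition contact_defect :: "(heis \<Rightarrow> heis) \<Rightarrow> heis \<Rightarrow> complex" where
  "contact_defect f p = Z_field (\<lambda>p. heis_proj (f p)) p
     - 2 * \<i> * cnj (fst (f p)) * Z_field (\<lambda>p. fst (f p)) p"

context
  fixes f :: "heis \<Rightarrow> heis" and D p
  assumes D: "(f has_derivative D) (at p)"
begin

lemma has_derivative_heis_proj_comp:
  "((\<lambda>p. heis_proj (f p)) has_derivative
    (\<lambda>v. of_real (snd (D v)) + \<i> * of_real (2 * (fst (f p) \<bullet> fst (D v))))) (at p)"
  using has_derivative_compose[OF D has_derivative_heis_proj] .

lemmas Z_fields =
  Z_field_has_derivative[OF has_derivative_fst[OF D]]
  Z_field_has_derivative[OF has_derivative_heis_proj_comp]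

text \<open>Only \<open>p\<close>, \<open>f p\<close> and the values of \<open>D\<close> at three
  fixed vectors occur, so continuity of the defect can be read off from that of \<open>f\<close> and
  its derivative.\<close>

lemma contact_defect_has_derivative:
  "contact_defect f p =
     (of_real (snd (D (1, 0))) + \<i> * of_real (2 * (fst (f p) \<bullet> fst (D (1, 0))))
       - \<i> * (of_real (snd (D (\<i>, 0))) + \<i> * of_real (2 * (fst (f p) \<bullet> fst (D (\<i>, 0)))))) / 2
     + \<i> * cnj (fst p) * (of_real (snd (D (0, 1))) + \<i> * of_real (2 * (fst (f p) \<bullet> fst (D (0, 1)))))
     - 2 * \<i> * cnj (fst (f p)) * ((fst (D (1, 0)) - \<i> * fst (D (\<i>, 0))) / 2
       + \<i> * cnj (fst p) * fst (D (0, 1)))"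
  by (simp add: contact_defect_def Z_fields)

text \<open>Expanding |f1|^2 turns the defect into Z f2 - i (cnj f1) (Z f1) + i f1 Z(cnj f1).
  Conjugation replaces Z h by Zbar(cnj h), fixes the real f2 and swaps the last two terms.\<close>

lemma cnj_contact_defect:
  "cnj (contact_defect f p) = Zbar_field (\<lambda>p. heis_proj (f p)) p
     - 2 * \<i> * cnj (fst (f p)) * Zbar_field (\<lambda>p. fst (f p)) p"
  unfolding contact_defect_def Z_fields
  by (simp add: complex_eq_iff inner_complex_def field_simps)

end

lemma continuous_on_contact_defect:
  assumes "C2_on f U"
  shows "continuous_on U (contact_defect f)"
proof -
  from assms obtain f' f'' where
    f': "\<And>x. x \<in> U \<Longrightarrow> (f has_derivative blinfun_apply (f' x)) (at x)" and
    f'': "\<And>x. x \<in> U \<Longrightarrow> (f' has_derivative blinfun_apply (f'' x)) (at x)"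
    unfolding C2_on_def by blast
  \<comment> \<open>\<open>f'\<close> is continuous because \<open>f''\<close> is its
    derivative.\<close>
  have [continuous_intros]: "continuous_on U f" "continuous_on U f'"
    using f' f'' by (meson has_derivative_continuous_on has_derivative_at_withinI)+
  show ?thesis
    by (subst continuous_on_cong[OF refl contact_defect_has_derivative[OF f']])
      (auto intro!: continuous_intros)
qed

lemma AE_Linfty_less_1:
  assumes "Linfty_less_1 U \<mu>"
  shows "AE x in lebesgue_on U. cmod (\<mu> x) < 1"
proof -
  have \<mu>: "\<mu> \<in> borel_measurable (lebesgue_on U)"
    and less: "esssup (lebesgue_on U) (\<lambda>x. ennreal (cmod (\<mu> x))) < 1"
    using assms by (auto simp: Linfty_less_1_def)
  show ?thesis
    using esssup_AE[of "\<lambda>x. ennreal (cmod (\<mu> x))" "lebesgue_on U"]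
  proof eventually_elim
    case (elim x)
    then have "ennreal (cmod (\<mu> x)) < ennreal 1"
      using less by (simp only: ennreal_1 le_less_trans)
    then show ?case
      by (subst (asm) ennreal_less_iff) auto
  qed
qed

text \<open>The Beltrami equations hold only almost everywhere. The set \<open>S\<close> where the
  defect is nonzero is open, and an open null set is empty.\<close>

lemma qc_heis_contact:
  assumes "qc_heis U V f" "p \<in> U"
  shows "contact_defect f p = 0"
proof (rule ccontr)
  assume "contact_defect f p \<noteq> 0"
  define S where "S = U \<inter> contact_defect f -` (- {0})"
  have U: "open U" and C2: "C2_on f U"
    using assms by (auto simp: qc_heis_def metric_qc_def is_domain_def)
  obtain \<mu> where \<mu>: "Linfty_less_1 U \<mu>" and Beltrami: "AE p in lebesgue_on U.
      Zbar_field (\<lambda>p. fst (f p)) p = \<mu> p * Z_field (\<lambda>p. fst (f p)) p \<and>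
      Zbar_field (\<lambda>p. heis_proj (f p)) p = \<mu> p * Z_field (\<lambda>p. heis_proj (f p)) p"
    using assms by (auto simp: qc_heis_def)
  have "open S"
    unfolding S_def using continuous_on_contact_defect[OF C2] U
    by (intro continuous_open_preimage) auto
  have "AE q in lebesgue_on U. q \<in> U \<longrightarrow> contact_defect f q = 0"
    using Beltrami AE_Linfty_less_1[OF \<mu>]
  proof eventually_elim
    case (elim q)
    show ?case
    proof
      assume "q \<in> U"
      then obtain D where D: "(f has_derivative D) (at q)"
        using C2 by (auto simp: C2_on_def)
      have "cnj (contact_defect f q) = \<mu> q * contact_defect f q"
        unfolding cnj_contact_defect[OF D] using elim(1)
        by (simp add: contact_defect_def algebra_simps)
      \<comment> \<open>Conjugation preserves the modulus, so \<open>cmod (\<mu> q) < 1\<close>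
        leaves only the value 0.\<close>
      from arg_cong[OF this, of cmod] have "cmod (contact_defect f q) = cmod (\<mu> q) * cmod (contact_defect f q)"
        by (simp add: norm_mult)
      then show "contact_defect f q = 0"
        using elim(2) by simp
    qed
  qed
  then have "AE q in lebesgue. q \<in> U \<longrightarrow> contact_defect f q = 0"
    using U by (subst (asm) AE_restrict_space_iff) auto
  \<comment> \<open>That \<open>S\<close> is null is phrased as membership in the closed set
    \<open>{}\<close>, which the next rule extends from almost every point of \<open>S\<close> to
    every point, in particular to \<open>p\<close>.\<close>
  then have "AE q\<in>S in lebesgue. q \<in> {}"
    by eventually_elim (auto simp: S_def)
  from mem_closed_if_AE_lebesgue_open[OF \<open>open S\<close> closed_empty this, of p] show False
    using assms(2) \<open>contact_defect f p \<noteq> 0\<close> by (auto simp: S_def)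
qed

text \<open>The defect and its conjugate both vanish, so \<open>2 * \<i> * cnj (fst (f p))\<close>
  is the common factor relating both derivatives of \<Pi> o f to those of the first
  component.\<close>

lemma cmod_Z_field_contact:
  assumes "(f has_derivative D) (at p)" "contact_defect f p = 0"
  shows "cmod (Z_field (\<lambda>p. heis_proj (f p)) p) - cmod (Zbar_field (\<lambda>p. heis_proj (f p)) p)
    = 2 * cmod (fst (f p)) *
      (cmod (Z_field (\<lambda>p. fst (f p)) p) - cmod (Zbar_field (\<lambda>p. fst (f p)) p))"
proof -
  have "Z_field (\<lambda>p. heis_proj (f p)) p = 2 * \<i> * cnj (fst (f p)) * Z_field (\<lambda>p. fst (f p)) p"
    using assms(2) by (simp add: contact_defect_def)
  moreover have "Zbar_field (\<lambda>p. heis_proj (f p)) p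
      = 2 * \<i> * cnj (fst (f p)) * Zbar_field (\<lambda>p. fst (f p)) p"
    using cnj_contact_defect[OF assms(1)] assms(2) by simp
  ultimately show ?thesis
    by (simp add: norm_mult algebra_simps)
qed

lemma heis_lift_half_plane:
  assumes "p \<in> heis_lift \<Omega>" "\<Omega> \<subseteq> half_plane"
  shows "heis_proj p \<in> \<Omega>" "fst p \<noteq> 0"
proof -
  obtain u w where "cmod u = 1" "w \<in> \<Omega>" "p = heis_Psi (u, w)"
    using assms(1) by (auto simp: heis_lift_def)
  moreover have "Im w > 0"
    using assms(2) \<open>w \<in> \<Omega>\<close> by (auto simp: half_plane_def)
  ultimately show "heis_proj p \<in> \<Omega>" "fst p \<noteq> 0"
    using heis_proj_Psi[of u w] by (auto simp: half_plane_def heis_Psi_def)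
qed

text \<open>In the application \<open>x\<close> and \<open>y\<close> are the dilatation factors of
  \<open>f\<close> and \<open>g\<close>. As \<open>a\<close> and \<open>b\<close> are positive,
  \<open>x\<close> and \<open>y\<close> have the same sign, and the case of a factor that is not
  positive is treated apart.\<close>

lemma ennreal_mult_divide_cross:
  fixes a b x y :: real and r :: ennreal
  assumes "a > 0" "b > 0" "a * x = b * y"
  shows "ennreal a * (r / ennreal y) = ennreal b * r / ennreal x"
proof (cases "x > 0")
  case True
  then have "y > 0"
    using assms by (metis mult_pos_pos zero_less_mult_pos)
  have "ennreal a * (r / ennreal y) = r * ennreal (a / y)"
    using \<open>y > 0\<close> assms
    by (simp add: divide_ennreal_def inverse_ennreal ennreal_mult' divide_inverse ac_simps)
  also have "a / y = b / x"
    using assms \<open>x > 0\<close> \<open>y > 0\<close> by (simp add: field_simps)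
  also have "r * ennreal (b / x) = ennreal b * r / ennreal x"
    using True assms
    by (simp add: divide_ennreal_def inverse_ennreal ennreal_mult' divide_inverse ac_simps)
  finally show ?thesis .
next
  case False
  then have "y \<le> 0"
    using assms by (smt (verit) mult_pos_pos zero_less_mult_pos)
  \<comment> \<open>Both denominators become 0 in \<open>ennreal\<close>, and \<open>r / 0\<close>
    is \<open>r * top\<close>, that is 0 or infinity, which positive finite factors do not
    change.\<close>
  with False assms show ?thesis
    by (simp add: ennreal_neg divide_ennreal_def ennreal_mult_top ac_simps)
       (metis assms(1,2) ennreal_eq_0_iff ennreal_mult_top ennreal_neq_top mult.commute mult.assoc not_le)
qed

theorem proposition1p0p8:
  fixes \<Omega> \<Omega>' :: "complex set" and \<Gamma> :: "curve set" and \<rho> :: "complex \<Rightarrow> ennreal"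
    and g :: "complex \<Rightarrow> complex" and f :: "heis \<Rightarrow> heis"
  assumes "is_domain \<Omega>" "\<Omega> \<subseteq> half_plane"
    and "is_domain \<Omega>'" "\<Omega>' \<subseteq> half_plane"
    and "\<forall>\<gamma>\<in>\<Gamma>. C1_curve_in \<Omega> \<gamma>"
    and "\<rho> \<in> adm \<Omega> \<Gamma>"
    and "qc_plane \<Omega> \<Omega>' g"
    and "qc_heis (heis_lift \<Omega>) (heis_lift \<Omega>') f"
    and "\<forall>p\<in>heis_lift \<Omega>. heis_proj (f p) = g (heis_proj p)"
  shows "\<forall>p\<in>heis_lift \<Omega>'.
    pull_proj (push_plane \<Omega> g \<rho>) p = push_heis (heis_lift \<Omega>) f (pull_proj \<rho>) p"
proof
  fix p' assume p': "p' \<in> heis_lift \<Omega>'"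
  define p where "p = inv_into (heis_lift \<Omega>) f p'"
  have "f ` heis_lift \<Omega> = heis_lift \<Omega>'"
    using assms(8) by (auto simp: qc_heis_def metric_qc_def homeomorphism_def)
  then have p: "p \<in> heis_lift \<Omega>" and fp: "f p = p'"
    using p' by (auto simp: p_def intro: inv_into_into f_inv_into_f)
  note \<Omega> = heis_lift_half_plane[OF p assms(2)]
  have z': "fst (f p) \<noteq> 0"
    using heis_lift_half_plane(2)[OF p' assms(4)] fp by simp
  have "inj_on g \<Omega>"
    using assms(7) by (auto simp: qc_plane_def metric_qc_def homeomorphism_def intro: inj_on_inverseI)
  \<comment> \<open>Since \<Pi> intertwines \<open>f\<close> and \<open>g\<close>, the point
    \<open>heis_proj p\<close> is mapped by \<open>g\<close> to \<open>heis_proj p'\<close>.\<close>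
  then have inv_g: "inv_into \<Omega> g (heis_proj p') = heis_proj p"
    using assms(9) p \<Omega>(1) fp by (metis inv_into_f_f)
  have "open (heis_lift \<Omega>)"
    using assms(8) by (simp add: qc_heis_def metric_qc_def is_domain_def)
  obtain D where D: "(f has_derivative D) (at p)"
    using assms(8) p by (auto simp: qc_heis_def C2_on_def)
  have g: "g differentiable (at (heis_proj p))"
    using assms(7) \<Omega>(1) by (auto simp: qc_plane_def C2_on_def differentiable_def)
  have "(\<lambda>p. heis_proj (f p)) differentiable (at p)"
    using has_derivative_heis_proj_comp[OF D] by (auto simp: differentiable_def)
  \<comment> \<open>\<Pi> o f and g o \<Pi> are known to agree only on the lift, but it is open, so
    their derivatives at \<open>p\<close> agree.\<close>
  note eq = Z_field_eqI[OF \<open>open (heis_lift \<Omega>)\<close> p bspec[OF assms(9)] this, unfolded Z_field_comp_heis_proj[OF g]]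
  \<comment> \<open>Both sides are half of |Z h| - |Zbar h| at \<open>p\<close> for h = \<Pi> o f =
    g o \<Pi>: the left by the contact property, the right by the chain rule.\<close>
  have "cmod (fst (f p)) * (cmod (Z_field (\<lambda>p. fst (f p)) p) - cmod (Zbar_field (\<lambda>p. fst (f p)) p))
      = cmod (fst p) * (cmod (d_w g (heis_proj p)) - cmod (d_wbar g (heis_proj p)))"
    using cmod_Z_field_contact[OF D qc_heis_contact[OF assms(8) p]]
    by (simp add: eq norm_mult algebra_simps)
  then show "pull_proj (push_plane \<Omega> g \<rho>) p' = push_heis (heis_lift \<Omega>) f (pull_proj \<rho>) p'"
    using \<Omega>(2) z' fp
    by (simp add: pull_proj_def Z_field_heis_proj norm_mult push_plane_def push_heis_def inv_g
        flip: p_def) (intro ennreal_mult_divide_cross; simp)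
qed

end
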